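(* Let $d,J\in\mathbb{N}$, let $a\in\mathbb{R}^d$, $b\in\mathbb{R}$, and let $G:\mathbb{R}^d\to\mathbb{R}$, $G(u)=a^Tu-b$. Let $\mathbf{u}(t)=\{u^{(j)}(t)\}_{j=1}^J\subset\mathbb{R}^d$ be an ensemble of particles evolving according to the noise-free continuous-time limit of the EnKF for rare event estimation associated with $G$ (defined in the context). At each time denote by $$S=\{k\in\{1,\dots,J\}: G(u^{(k)})\ge 0\},\qquad F=\{k\in\{1,\dots,J\}: G(u^{(k)})<0\}$$ the index sets of the safe and of the failure particles. Then the safe particles ($j\in S$) satisfy the flow $$\frac{\mathrm{d}u^{(j)}}{\mathrm{d}t}=-C_{\mathrm{uu}}(\mathbf{u})\,D_u\left(\frac12 G(u^{(j)})^2\right)+\frac{G(u^{(j)})}{J}\sum_{k\in F}G(u^{(k)})\left(u^{(k)}-\overline{u}\right),$$ while the failure particles do not move, i.e. $\frac{\mathrm{d}u^{(j)}}{\mathrm{d}t}=0$ for $j\in F$.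
   Context: Auxiliary limit-state function: $\widetilde{G}(u)=\max\{0,G(u)\}$. Empirical quantities of an ensemble $\mathbf{u}=\{u^{(j)}\}_{j=1}^J$: $\overline{u}=\frac1J\sum_{k=1}^J u^{(k)}$, $\overline{\widetilde{G}}=\frac1J\sum_{k=1}^J\widetilde{G}(u^{(k)})$, $C_{\mathrm{uu}}(\mathbf{u})=\frac1J\sum_{k=1}^J(u^{(k)}-\overline{u})(u^{(k)}-\overline{u})^T$, $C_{\mathrm{up}}(\mathbf{u})=\frac1J\sum_{k=1}^J(u^{(k)}-\overline{u})\,(\widetilde{G}(u^{(k)})-\overline{\widetilde{G}})\in\mathbb{R}^d$, $C_{\mathrm{pp}}(\mathbf{u})=\frac1J\sum_{k=1}^J(\widetilde{G}(u^{(k)})-\overline{\widetilde{G}})^2\in\mathbb{R}$. The EnKF for rare event estimation uses the forward map $\widetilde{G}$, the data $y^\dagger=0$ and the noise variance $\Gamma=1$. In the noise-free case (the data are not perturbed, $y_{n+1}^{(j)}=y^\dagger=0$), one step with step size $h$ is $$u_{n+1}^{(j)}=u_n^{(j)}+C_{\mathrm{up}}(\mathbf{u_n})\left(C_{\mathrm{pp}}(\mathbf{u_n})+\tfrac1h\right)^{-1}\left(0-\widetilde{G}(u_n^{(j)})\right),\quad j=1,\dots,J.$$ Its continuous-time limit $h\to0$ is the system of ordinary differential equations $$\frac{\mathrm{d}u^{(j)}}{\mathrm{d}t}=C_{\mathrm{up}}(\mathbf{u})\left(0-\widetilde{G}(u^{(j)})\right)=\frac1J\sum_{k=1}^J\left(\widetilde{G}(u^{(k)})-\overline{\widetilde{G}}\right)\left(-\widetilde{G}(u^{(j)})\right)\left(u^{(k)}-\overline{u}\right),\quad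 j=1,\dots,J.$$ $D_u$ denotes the gradient with respect to $u$, so $D_u(\frac12G(u)^2)=G(u)\,a$. The failure surface $\{G=0\}$ is counted as part of the safe domain. *)

theory Defs
  imports "HOL-Analysis.Analysis"
begin

text \<open>
  An ensemble of \<open>J\<close> particles is a function \<open>u :: nat \<Rightarrow> real ^ 'd\<close>, of which only the
  values at the indices \<open>1, \<dots>, J\<close> are used.
\<close>

definition aux_lsf :: "('a \<Rightarrow> real) \<Rightarrow> 'a \<Rightarrow> real" where
  "aux_lsf G x = max 0 (G x)"

definition emp_mean :: "nat \<Rightarrow> (nat \<Rightarrow> 'a::real_vector) \<Rightarrow> 'a" where
  "emp_mean J x = (1 / real J) *\<^sub>R (\<Sum>k=1..J. x k)"

text \<open>
  \<open>columnvector v ** rowvector v\<close> is the outer product of \<open>v\<close> with itself only if the inner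
  dimension is 1, which the library does not enforce; hence the type constraint.
\<close>

definition C_uu :: "nat \<Rightarrow> (nat \<Rightarrow> real ^ 'd) \<Rightarrow> real ^ 'd ^ 'd" where
  "C_uu J u = (1 / real J) *\<^sub>R
     (\<Sum>k=1..J. (columnvector (u k - emp_mean J u) :: real ^ 1 ^ 'd) ** rowvector (u k - emp_mean J u))"

definition C_up :: "nat \<Rightarrow> (real ^ 'd \<Rightarrow> real) \<Rightarrow> (nat \<Rightarrow> real ^ 'd) \<Rightarrow> real ^ 'd" where
  "C_up J G u = (1 / real J) *\<^sub>R
     (\<Sum>k=1..J. (aux_lsf G (u k) - emp_mean J (\<lambda>i. aux_lsf G (u i))) *\<^sub>R (u k - emp_mean J u))"

text \<open>
  Noise-free continuous-time limit of the EnKF for the forward map \<open>aux_lsf G\<close>, the data \<open>0\<close>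
  and the noise variance \<open>1\<close>, on the time set \<open>T\<close>; derivatives at end points belonging to \<open>T\<close>
  are one-sided.
\<close>

definition enkf_flow ::
  "nat \<Rightarrow> (real ^ 'd \<Rightarrow> real) \<Rightarrow> real set \<Rightarrow> (real \<Rightarrow> nat \<Rightarrow> real ^ 'd) \<Rightarrow> bool" where
  "enkf_flow J G T u \<longleftrightarrow>
     (\<forall>t\<in>T. \<forall>j\<in>{1..J}.
        ((\<lambda>s. u s j) has_vector_derivative (0 - aux_lsf G (u t j)) *\<^sub>R C_up J G (u t))
          (at t within T))"

definition safe_idx :: "nat \<Rightarrow> ('a \<Rightarrow> real) \<Rightarrow> (nat \<Rightarrow> 'a) \<Rightarrow> nat set" where
  "safe_idx J G u = {k \<in> {1..J}. G (u k) \<ge> 0}"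

definition fail_idx :: "nat \<Rightarrow> ('a \<Rightarrow> real) \<Rightarrow> (nat \<Rightarrow> 'a) \<Rightarrow> nat set" where
  "fail_idx J G u = {k \<in> {1..J}. G (u k) < 0}"

definition gradient :: "('a::real_inner \<Rightarrow> real) \<Rightarrow> 'a \<Rightarrow> 'a" where
  "gradient f x = (THE D. GDERIV f x :> D)"

end

theory Submission
  imports Defs
begin

text \<open>
  A failure particle has \<open>aux_lsf G (u t j) = 0\<close>, and this number is a factor of its velocity.
  A safe particle has \<open>aux_lsf G (u t j) = G (u t j)\<close>, so its velocity is \<open>- G (u t j)\<close> times
  \<open>C_up\<close>, and everything rests on a formula for \<open>C_up\<close> when \<open>G\<close> is affine.

  Since the deviations \<open>u k - emp_mean J u\<close> add up to zero, a constant may be added to the weights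
  of a weighted sum of deviations without changing it. Hence the mean of the auxiliary limit-state
  function drops out of \<open>C_up\<close>, whose weights become \<open>aux_lsf G (u k)\<close>, that is, \<open>G (u k)\<close> with the
  negative values (those of the failure particles) removed. For the same reason the weights
  \<open>G (u k) = a \<bullet> u k - b\<close> of the complete sum may be replaced by \<open>a \<bullet> (u k - emp_mean J u)\<close>, which
  turns this sum into the product of \<open>C_uu\<close> with \<open>a\<close>. So \<open>C_up\<close> is \<open>C_uu *v a\<close> minus the
  contribution of the failure particles (lemma \<open>C_up_affine\<close>). The gradient of \<open>(G x)\<^sup>2 / 2\<close> being
  \<open>G x *\<^sub>R a\<close>, multiplication by \<open>- G (u t j)\<close> gives the asserted flow.
\<close>

text \<open>The definite description in \<open>gradient\<close> is meaningful because gradients are unique.\<close>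

lemma gradient_eqI:
  assumes "GDERIV f x :> D"
  shows "gradient f x = D"
  unfolding gradient_def
proof (rule the_equality)
  fix E assume "GDERIV f x :> E"
  with assms have "(\<lambda>h. h \<bullet> E) = (\<lambda>h. h \<bullet> D)"
    unfolding gderiv_def by (rule has_derivative_unique[rotated])
  then show "E = D"
    by (metis vector_eq_ldot)
qed (fact assms)

lemma gradient_half_square_affine:
  "gradient (\<lambda>x. 1 / 2 * (a \<bullet> x - b)\<^sup>2) x = (a \<bullet> x - b) *\<^sub>R a"
  by (rule gradient_eqI)
     (auto simp: gderiv_def fun_eq_iff inner_commute[of a] inner_diff_right field_simps
       intro!: derivative_eq_intros)

lemma sum_deviations:
  "(\<Sum>k=1..J. x k - emp_mean J x) = 0"
  by (cases "J = 0") (simp_all add: emp_mean_def sum_subtractf sum_constant_scaleR)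

text \<open>
  Centring either factor of an empirical covariance is enough: because the deviations add up to
  zero, a common shift \<open>c\<close> of the weights has no effect.
\<close>

lemma sum_deviations_shift_weights:
  "(\<Sum>k=1..J. (w k - c) *\<^sub>R (x k - emp_mean J x)) = (\<Sum>k=1..J. w k *\<^sub>R (x k - emp_mean J x))"
  by (simp only: scaleR_left_diff_distrib sum_subtractf[of "\<lambda>k. w k *\<^sub>R _ k"]
      scaleR_sum_right[symmetric] sum_deviations scaleR_zero_right diff_0_right)

lemma outer_product_mult_vec:
  fixes v w x :: "real ^ 'd"
  shows "((columnvector v :: real ^ 1 ^ 'd) ** rowvector w) *v x = (w \<bullet> x) *\<^sub>R v"
  by (simp add: vec_eq_iff matrix_vector_mult_def matrix_matrix_mult_def columnvector_def
      rowvector_def inner_vec_def sum_distrib_right sum_distrib_left mult_ac)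

lemma sum_matrix_vector_mult:
  fixes A :: "'i \<Rightarrow> real ^ 'n ^ 'm"
  shows "(\<Sum>i\<in>I. A i) *v x = (\<Sum>i\<in>I. A i *v x)"
  by (induction I rule: infinite_finite_induct)
     (simp_all add: matrix_vector_mult_add_rdistrib)

lemma C_uu_mult_vec:
  "C_uu J u *v x = (1 / real J) *\<^sub>R (\<Sum>k=1..J. ((u k - emp_mean J u) \<bullet> x) *\<^sub>R (u k - emp_mean J u))"
  unfolding C_uu_def
  by (simp only: scaleR_matrix_vector_assoc[symmetric] sum_matrix_vector_mult
      outer_product_mult_vec)

lemma C_up_eq_uncentred:
  "C_up J G u = (1 / real J) *\<^sub>R (\<Sum>k=1..J. aux_lsf G (u k) *\<^sub>R (u k - emp_mean J u))"
  unfolding C_up_def by (simp only: sum_deviations_shift_weights)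

text \<open>
  The cut-off in \<open>aux_lsf\<close> only affects the failure particles. Without it, an affine \<open>G\<close> makes the
  cross-covariance linear in the deviations, and it becomes \<open>C_uu J u *v a\<close>; the correction is what
  the failure particles would have contributed.
\<close>

lemma C_up_affine:
  fixes a :: "real ^ 'd"
  assumes G: "\<And>x. G x = a \<bullet> x - b"
  shows "C_up J G u = C_uu J u *v a
           - (1 / real J) *\<^sub>R (\<Sum>k\<in>fail_idx J G u. G (u k) *\<^sub>R (u k - emp_mean J u))"
proof -
  let ?e = "\<lambda>k. u k - emp_mean J u"
  have full: "(\<Sum>k=1..J. G (u k) *\<^sub>R ?e k) = (\<Sum>k=1..J. (?e k \<bullet> a) *\<^sub>R ?e k)"
  proof -
    have "?e k \<bullet> a = G (u k) - G (emp_mean J u)" for k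
      by (simp add: G inner_diff_left inner_commute[of a])
    then show ?thesis
      by (simp only: sum_deviations_shift_weights)
  qed
  have "(\<Sum>k=1..J. aux_lsf G (u k) *\<^sub>R ?e k)
      = (\<Sum>k=1..J. G (u k) *\<^sub>R ?e k - (if G (u k) < 0 then G (u k) *\<^sub>R ?e k else 0))"
    by (intro sum.cong) (auto simp: aux_lsf_def max_def)
  also have "\<dots> = (\<Sum>k=1..J. G (u k) *\<^sub>R ?e k) - (\<Sum>k\<in>fail_idx J G u. G (u k) *\<^sub>R ?e k)"
    unfolding fail_idx_def sum_subtractf by (subst sum.inter_filter) simp_all
  finally show ?thesis
    unfolding C_up_eq_uncentred C_uu_mult_vec full by (simp only: real_vector.scale_right_diff_distrib)
qed

theorem theorem4p1:
  fixes a :: "real ^ 'd" and b :: real and J :: nat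
    and G :: "real ^ 'd \<Rightarrow> real"
    and T :: "real set"
    and u :: "real \<Rightarrow> nat \<Rightarrow> real ^ 'd"
  assumes G: "\<And>x. G x = a \<bullet> x - b"
    and T: "is_interval T"
    and flow: "enkf_flow J G T u"
  shows "\<forall>t\<in>T.
      (\<forall>j\<in>safe_idx J G (u t).
         ((\<lambda>s. u s j) has_vector_derivative
            (- (C_uu J (u t) *v gradient (\<lambda>x. 1 / 2 * (G x)\<^sup>2) (u t j))
             + (G (u t j) / real J) *\<^sub>R
                 (\<Sum>k\<in>fail_idx J G (u t). G (u t k) *\<^sub>R (u t k - emp_mean J (u t)))))
           (at t within T)) \<and>
      (\<forall>j\<in>fail_idx J G (u t).
         ((\<lambda>s. u s j) has_vector_derivative 0) (at t within T))"
proof (intro ballI conjI)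
  fix t j assume t: "t \<in> T" and "j \<in> safe_idx J G (u t)"
  then have j: "j \<in> {1..J}" and "aux_lsf G (u t j) = G (u t j)"
    by (auto simp: safe_idx_def aux_lsf_def)
  have "gradient (\<lambda>x. 1 / 2 * (G x)\<^sup>2) (u t j) = G (u t j) *\<^sub>R a"
    unfolding G by (rule gradient_half_square_affine)
  with \<open>aux_lsf G (u t j) = G (u t j)\<close> have velocity: "(0 - aux_lsf G (u t j)) *\<^sub>R C_up J G (u t)
      = - (C_uu J (u t) *v gradient (\<lambda>x. 1 / 2 * (G x)\<^sup>2) (u t j))
        + (G (u t j) / real J) *\<^sub>R
            (\<Sum>k\<in>fail_idx J G (u t). G (u t k) *\<^sub>R (u t k - emp_mean J (u t)))"
    by (simp only: C_up_affine[OF G] matrix_vector_mult_scaleR) (simp add: scaleR_right_diff_distrib)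
  show "((\<lambda>s. u s j) has_vector_derivative
          (- (C_uu J (u t) *v gradient (\<lambda>x. 1 / 2 * (G x)\<^sup>2) (u t j))
           + (G (u t j) / real J) *\<^sub>R
               (\<Sum>k\<in>fail_idx J G (u t). G (u t k) *\<^sub>R (u t k - emp_mean J (u t)))))
         (at t within T)"
    using flow t j unfolding enkf_flow_def velocity[symmetric] by blast
next
  fix t j assume t: "t \<in> T" and "j \<in> fail_idx J G (u t)"
  then have j: "j \<in> {1..J}" and "aux_lsf G (u t j) = 0"
    by (auto simp: fail_idx_def aux_lsf_def)
  then have "(0 - aux_lsf G (u t j)) *\<^sub>R C_up J G (u t) = 0"
    by simp
  with flow t j show "((\<lambda>s. u s j) has_vector_derivative 0) (at t within T)"
    unfolding enkf_flow_def by metis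
qed

end
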